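(* Suppose $N\ge 4$ and $\theta_i=\theta$ for all $i\in[N]$. Then $c$ is weakly concave on $\Lambda$ if $$\overline{\lambda}_i<\frac{\theta}{N-3},\qquad\forall i\in[N].$$
   Context: Fix an integer $N\ge 1$ and write $[N]=\{1,\dots,N\}$. Costs $c_{(i)}>0$ and $c_{(i,j)}>0$ ($i,j\in[N]$) are given with $c_{(i)}=c_{(i,i)}\le c_{(i,j)}=c_{(j,i)}$ for all $i,j\in[N]$. The parameters $\theta_i>0$ ($i\in[N]$) are given. The domain is the box $\Lambda=[\underline{\boldsymbol{\lambda}},\overline{\boldsymbol{\lambda}}]=\{\boldsymbol{\lambda}\in\mathbb{R}^N:\underline{\lambda}_i\le\lambda_i\le\overline{\lambda}_i\ \forall i\}$ with $\underline{\lambda}_i>0$ for all $i$. For $\boldsymbol{\lambda}\in\Lambda$, $c(\boldsymbol{\lambda})$ is the optimal value of the linear program in variables $\boldsymbol{x}=(x_{i,j})_{i,j\in[N]}$, $\boldsymbol{y}=(y_i)_{i\in[N]}$: minimize $\sum_{i,j\in[N]}c_{(i,j)}x_{i,j}+\sum_{i\in[N]}c_{(i)}y_i$ subject to $\sum_{j\in[N]}x_{j,i}+\sum_{j\in[N]}x_{i,j}+y_i=\lambda_i$ for all $i\in[N]$; $\theta_i x_{i,j}\le\lambda_j y_i$ for all $i,j\in[N]$; $x_{i,j}\ge 0$ for all $i,j\in[N]$; $y_i\ge 0$ for all $i\in[N]$. Weak concavity: $c$ is weakly concave on $\Lambda$ if there exists a finite $\rho\ge 0$ such that $\boldsymbol{\lambda}\mapsto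 c(\boldsymbol{\lambda})-\rho\|\boldsymbol{\lambda}\|^2/2$ is concave on $\Lambda$, with $\|\cdot\|$ the Euclidean norm. *)

theory Defs
  imports "HOL-Analysis.Analysis"
begin

text \<open>
  The index set \<open>{1, \<dots>, N}\<close> is a finite type, so \<open>N\<close> is its cardinality.  The costs
  \<open>c\<^sub>(\<^sub>i\<^sub>)\<close> and \<open>c\<^sub>(\<^sub>i\<^sub>,\<^sub>j\<^sub>)\<close> are \<open>cs i\<close> and \<open>cp i j\<close>.
\<close>

definition lp_feasible ::
    "('n::finite \<Rightarrow> real) \<Rightarrow> real ^ 'n \<Rightarrow> ((real ^ 'n ^ 'n) \<times> (real ^ 'n)) set" where
  "lp_feasible \<theta> l =
    {(x, y).
       (\<forall>i. (\<Sum>j\<in>UNIV. x $ j $ i) + (\<Sum>j\<in>UNIV. x $ i $ j) + y $ i = l $ i) \<and>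
       (\<forall>i j. \<theta> i * x $ i $ j \<le> l $ j * y $ i) \<and>
       (\<forall>i j. 0 \<le> x $ i $ j) \<and>
       (\<forall>i. 0 \<le> y $ i)}"

definition lp_objective ::
    "('n::finite \<Rightarrow> real) \<Rightarrow> ('n \<Rightarrow> 'n \<Rightarrow> real) \<Rightarrow> (real ^ 'n ^ 'n) \<times> (real ^ 'n) \<Rightarrow> real" where
  "lp_objective cs cp =
    (\<lambda>(x, y). (\<Sum>i\<in>UNIV. \<Sum>j\<in>UNIV. cp i j * x $ i $ j) + (\<Sum>i\<in>UNIV. cs i * y $ i))"

definition lp_value ::
    "('n::finite \<Rightarrow> real) \<Rightarrow> ('n \<Rightarrow> 'n \<Rightarrow> real) \<Rightarrow> ('n \<Rightarrow> real) \<Rightarrow> real ^ 'n \<Rightarrow> real" where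
  "lp_value cs cp \<theta> l = (INF z\<in>lp_feasible \<theta> l. lp_objective cs cp z)"

definition weakly_concave_on :: "('a::real_normed_vector) set \<Rightarrow> ('a \<Rightarrow> real) \<Rightarrow> bool" where
  "weakly_concave_on S f \<longleftrightarrow> (\<exists>\<rho>\<ge>0. concave_on S (\<lambda>l. f l - \<rho> * (norm l)\<^sup>2 / 2))"

text \<open>
  The infimum in \<^const>\<open>lp_value\<close> is a real infimum, which is unspecified for empty or unbounded
  sets.  On nonnegative \<open>l\<close> this does not occur: the program is feasible and its infimum is
  attained.
\<close>

lemma lp_feasible_nonempty:
  assumes "\<And>i. 0 \<le> l $ i"
  shows "(0, l) \<in> lp_feasible \<theta> l"
  using assms by (auto simp: lp_feasible_def)

lemma compact_lp_feasible: "compact (lp_feasible \<theta> l)"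
proof -
  let ?S = "lp_feasible \<theta> l"
  have "closed ?S"
    unfolding lp_feasible_def case_prod_beta
    by (intro closed_Collect_conj closed_Collect_all closed_Collect_eq closed_Collect_le
        continuous_intros)
  moreover have "?S \<subseteq> cbox (0, 0) (\<chi> i j. l $ i, l)"
  proof (rule subsetI)
    fix z assume z: "z \<in> ?S"
    obtain x y where [simp]: "z = (x, y)" by (cases z)
    from z have eq: "\<And>i. (\<Sum>j\<in>UNIV. x $ j $ i) + (\<Sum>j\<in>UNIV. x $ i $ j) + y $ i = l $ i"
      and x: "\<And>i j. 0 \<le> x $ i $ j" and y: "\<And>i. 0 \<le> y $ i"
      by (auto simp: lp_feasible_def)
    have s: "0 \<le> (\<Sum>j\<in>UNIV. x $ j $ i)" "0 \<le> (\<Sum>j\<in>UNIV. x $ i $ j)" for i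
      using x by (auto intro: sum_nonneg)
    have "x $ i $ j \<le> (\<Sum>j\<in>UNIV. x $ i $ j)" for i j
      by (rule member_le_sum) (use x in auto)
    then have "x $ i $ j \<le> l $ i" for i j
      by (rule order_trans) (use eq[of i] s[of i] y[of i] in linarith)
    moreover have "y $ i \<le> l $ i" for i
      using eq[of i] s[of i] by linarith
    ultimately have "x \<in> cbox 0 (\<chi> i j. l $ i)" "y \<in> cbox 0 l"
      using x y by (auto simp: mem_box Basis_vec_def inner_axis)
    then show "z \<in> cbox (0, 0) (\<chi> i j. l $ i, l)"
      by (simp add: cbox_Pair_eq)
  qed
  ultimately show ?thesis
    using bounded_subset[OF bounded_cbox] by (simp add: compact_eq_bounded_closed)
qed

lemma lp_value_attained:
  assumes "\<And>i. 0 \<le> l $ i"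
  obtains z where "z \<in> lp_feasible \<theta> l" and "lp_objective cs cp z = lp_value cs cp \<theta> l"
    and "\<And>w. w \<in> lp_feasible \<theta> l \<Longrightarrow> lp_objective cs cp z \<le> lp_objective cs cp w"
proof -
  have "continuous_on (lp_feasible \<theta> l) (lp_objective cs cp)"
    unfolding lp_objective_def case_prod_beta by (intro continuous_intros)
  then obtain z where z: "z \<in> lp_feasible \<theta> l"
    "\<And>w. w \<in> lp_feasible \<theta> l \<Longrightarrow> lp_objective cs cp z \<le> lp_objective cs cp w"
    using continuous_attains_inf[OF compact_lp_feasible, of \<theta> l "lp_objective cs cp"]
      lp_feasible_nonempty[of l \<theta>, OF assms] by (metis empty_iff)
  then have "lp_objective cs cp z = lp_value cs cp \<theta> l"
    unfolding lp_value_def by (intro cInf_eq_minimum[symmetric]) auto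
  with z show thesis using that by blast
qed

end

theory Submission
  imports Defs
begin

text \<open>
  Put \<open>a\<^sub>j = \<lambda>\<^sub>j / \<theta>\<close>.  Eliminating the dual variables of the capacity constraints leaves a vector
  \<open>u\<close> with \<open>u\<^sub>i + (\<Sum>j. a\<^sub>j max 0 (u\<^sub>i + u\<^sub>j - c\<^sub>(\<^sub>i\<^sub>,\<^sub>j\<^sub>))) \<le> c\<^sub>(\<^sub>i\<^sub>)\<close>; Brouwer's theorem gives a
  \<open>u\<close> attaining equality everywhere.  The bound \<open>(N - 3) a\<^sub>j < 1\<close> says \<open>a\<^sub>j / (1 + 2 a\<^sub>j) < 1 / (N - 1)\<close>,
  and this is used twice.  First, \<open>2 u\<^sub>i > c\<^sub>(\<^sub>i\<^sub>)\<close>, so the capacity constraints of all the \<open>x\<^sub>i\<^sub>,\<^sub>i\<close> can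
  be made tight.  Secondly, for any symmetric pattern \<open>w\<close> of tight capacity constraints that
  contains the diagonal, the primal vector \<open>y\<^sub>i = \<lambda>\<^sub>i z\<^sub>i\<close> determined by
  \<open>z\<^sub>i + (\<Sum>j. a\<^sub>j w\<^sub>i\<^sub>j (z\<^sub>i + z\<^sub>j)) = 1\<close> is nonnegative, hence feasible at every point of the box.

  Take \<open>w\<close> to be the pattern read off from \<open>u\<close> at a point \<open>p\<close>.  The cost of the resulting
  feasible point at \<open>\<lambda>\<close> is an upper bound for the value that is exact at \<open>p\<close>, and the system for \<open>z\<close>
  has an inverse bounded by 1 in the maximum norm.  So this bound is linear in \<open>\<lambda> - p\<close> up to a
  quadratic error that is uniform in \<open>p\<close>, and such quadratic supports from above give weak concavity.
\<close>

section \<open>Concavity from quadratic supports\<close>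

text \<open>Subtracting \<open>C * (norm l)\<^sup>2\<close> turns each quadratic support into an
  affine one touching at \<open>p\<close>, and such supports at every point of a convex set force
  concavity. The slope may vary with \<open>p\<close>; the constant \<open>C\<close> may
  not.\<close>

lemma weakly_concave_onI_quadratic_support:
  fixes f :: "'a::real_inner \<Rightarrow> real"
  assumes "convex S" "0 \<le> C"
    and supp: "\<And>p. p \<in> S \<Longrightarrow> \<exists>s. \<forall>l\<in>S. f l \<le> f p + s \<bullet> (l - p) + C * (norm (l - p))\<^sup>2"
  shows "weakly_concave_on S f"
proof -
  define h where "h l = f l - (2 * C) * (norm l)\<^sup>2 / 2" for l
  have "concave_on S h"
    unfolding concave_on_iff
  proof (intro conjI ballI allI impI)
    fix x y t r assume xy: "x \<in> S" "y \<in> S" and t: "0 \<le> t" "0 \<le> r" "t + r = (1::real)"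
    define p where "p = t *\<^sub>R x + r *\<^sub>R y"
    have p: "p \<in> S"
      unfolding p_def using \<open>convex S\<close> xy t by (simp add: convex_def)
    from supp[OF p] obtain s
      where s: "\<And>l. l \<in> S \<Longrightarrow> f l \<le> f p + s \<bullet> (l - p) + C * (norm (l - p))\<^sup>2" by blast
    \<comment> \<open>The shift comes from \<open>(norm l)\<^sup>2 - (norm (l - p))\<^sup>2 = (norm
      p)\<^sup>2 + 2 * (p \<bullet> (l - p))\<close>.\<close>
    define s' where "s' = s - (2 * C) *\<^sub>R p"
    have h: "h l \<le> h p + s' \<bullet> (l - p)" if "l \<in> S" for l
      using s[OF that] unfolding h_def s'_def power2_norm_eq_inner
      by (simp add: algebra_simps inner_commute)
    have "t * h x + r * h y \<le> t * (h p + s' \<bullet> (x - p)) + r * (h p + s' \<bullet> (y - p))"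
      by (intro add_mono mult_left_mono h xy t)
    also have "\<dots> = (t + r) * h p + s' \<bullet> (t *\<^sub>R x + r *\<^sub>R y - (t + r) *\<^sub>R p)"
      by (simp add: algebra_simps)
    also have "\<dots> = h p"
      by (simp add: t p_def)
    finally show "t * h x + r * h y \<le> h (t *\<^sub>R x + r *\<^sub>R y)"
      by (simp add: p_def)
  qed (use \<open>convex S\<close> in auto)
  then show ?thesis
    unfolding weakly_concave_on_def h_def using \<open>0 \<le> C\<close>
    by (intro exI[of _ "2 * C"]) auto
qed

section \<open>Coupled systems: existence, stability and sign\<close>

text \<open>Brouwer's theorem on a box. The sandwich on \<open>\<phi>\<close> covers both uses:
  \<open>max 0 (s - c)\<close> with \<open>c\<close> positive for the dual vector, and
  \<open>w * s\<close> with \<open>w\<close> in \<open>[0, 1]\<close> for the primal one.\<close>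

lemma coupled_system_solvable:
  fixes a b :: "'n::finite \<Rightarrow> real" and \<phi> :: "'n \<Rightarrow> 'n \<Rightarrow> real \<Rightarrow> real"
  assumes a: "\<And>j. 0 \<le> a j" and b: "\<And>i. \<bar>b i\<bar> \<le> B"
    and cont: "\<And>i j. continuous_on UNIV (\<phi> i j)"
    and \<phi>: "\<And>i j s. min 0 s \<le> \<phi> i j s" "\<And>i j s. \<phi> i j s \<le> max 0 s"
  obtains u where "\<And>i. u i + (\<Sum>j\<in>UNIV. a j * \<phi> i j (u i + u j)) = b i"
    and "\<And>i. \<bar>u i\<bar> \<le> B"
proof -
  define A where "A = sum a UNIV"
  have A: "0 \<le> A"
    unfolding A_def using a by (simp add: sum_nonneg)
  define G where "G u i = (\<Sum>j\<in>UNIV. a j * \<phi> i j (u $ i + u $ j))" for u :: "real ^ 'n" and i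
  \<comment> \<open>Fixed points of \<open>T\<close> are exactly the solutions. In the box,
    \<open>\<phi> i j\<close> at \<open>u $ i + u $ j\<close> lies between \<open>u $ i - B\<close>
    and \<open>u $ i + B\<close>, so \<open>A * u $ i - G u i\<close> is at most
    \<open>A * B\<close> in modulus, and dividing by \<open>1 + A\<close> returns \<open>T u\<close>
    to the box.\<close>
  define T :: "real ^ 'n \<Rightarrow> real ^ 'n" where "T u = (\<chi> i. (A * u $ i + b i - G u i) / (1 + A))" for u
  let ?K = "cbox (\<chi> i. - B) (\<chi> i. B) :: (real ^ 'n) set"
  have "0 \<le> B"
    using b[of undefined] by linarith
  have "continuous_on ?K T"
    unfolding T_def G_def using A
    by (intro continuous_intros continuous_on_compose2[OF cont]) auto
  moreover have "T \<in> ?K \<rightarrow> ?K"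
  proof
    fix u assume "u \<in> ?K"
    then have u: "- B \<le> u $ i" "u $ i \<le> B" for i
      by (auto simp: mem_box_cart)
    have uB: "0 \<le> u $ i + B" "u $ i - B \<le> 0" for i
      using u(1)[of i] u(2)[of i] by linarith+
    have "G u i \<le> (\<Sum>j\<in>UNIV. a j * (u $ i + B))" for i
      unfolding G_def
      by (intro sum_mono mult_left_mono order_trans[OF \<phi>(2)] a) (use uB u(2) in auto)
    moreover have "(\<Sum>j\<in>UNIV. a j * (u $ i - B)) \<le> G u i" for i
      unfolding G_def
      by (intro sum_mono mult_left_mono order_trans[OF _ \<phi>(1)] a)
        (use uB u(1) in \<open>auto simp: algebra_simps\<close>)
    ultimately have "\<bar>A * u $ i + b i - G u i\<bar> \<le> (1 + A) * B" for i
      using b[of i] unfolding sum_distrib_right[symmetric] A_def[symmetric]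
      by (simp add: algebra_simps abs_le_iff) (smt (verit))
    then have "\<bar>T u $ i\<bar> \<le> B" for i
      using A by (simp add: T_def divide_le_eq abs_divide mult.commute)
    then show "T u \<in> ?K"
      by (auto simp: mem_box_cart abs_le_iff minus_le_iff)
  qed
  moreover have "?K \<noteq> {}"
    using \<open>0 \<le> B\<close> by (simp add: interval_ne_empty_cart)
  ultimately obtain u where u: "u \<in> ?K" "T u = u"
    using brouwer[OF compact_cbox convex_box(1)] by blast
  have "u $ i + G u i = b i" for i
  proof -
    have "(A * u $ i + b i - G u i) / (1 + A) = u $ i"
      using arg_cong[OF u(2), of "\<lambda>v. v $ i"] by (simp only: T_def vec_lambda_beta)
    then show ?thesis
      using A by (simp add: field_simps)
  qed
  moreover have "\<bar>u $ i\<bar> \<le> B" for i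
    using u(1) by (auto simp: mem_box_cart abs_le_iff minus_le_iff)
  ultimately show thesis
    using that[of "($) u"] by (simp add: G_def)
qed

text \<open>A maximum principle: where \<open>\<bar>d i\<bar>\<close> is largest, no
  \<open>d i + d j\<close> has the sign opposite to \<open>d i\<close>, so the coupling sum cannot
  cancel any part of \<open>d i\<close>. It serves to make solutions Lipschitz in the data.\<close>

lemma coupled_system_abs_le:
  fixes a d :: "'n::finite \<Rightarrow> real" and w :: "'n \<Rightarrow> 'n \<Rightarrow> real"
  assumes a: "\<And>j. 0 \<le> a j" and w: "\<And>i j. 0 \<le> w i j"
    and e: "\<And>i. \<bar>d i + (\<Sum>j\<in>UNIV. a j * (w i j * (d i + d j)))\<bar> \<le> e"
  shows "\<bar>d k\<bar> \<le> e"
proof -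
  obtain i where i: "\<And>j. \<bar>d j\<bar> \<le> \<bar>d i\<bar>"
    using ex_is_arg_min_if_finite[of "UNIV :: 'n set" "\<lambda>i. - \<bar>d i\<bar>"]
    by (auto simp: is_arg_min_linorder)
  let ?s = "\<Sum>j\<in>UNIV. a j * (w i j * (d i + d j))"
  have "\<bar>d i\<bar> \<le> e"
  proof (cases "0 \<le> d i")
    case True
    then have "0 \<le> d i + d j" for j
      using i[of j] by linarith
    then have "0 \<le> ?s"
      by (intro sum_nonneg mult_nonneg_nonneg a w)
    with e[of i] True show ?thesis by linarith
  next
    case False
    then have "d i + d j \<le> 0" for j
      using i[of j] by linarith
    then have "?s \<le> 0"
      by (intro sum_nonpos mult_nonneg_nonpos a w)
    with e[of i] False show ?thesis by linarith
  qed
  with i[of k] show ?thesis by linarith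
qed

text \<open>If the least entry \<open>z i\<close> were negative, the off-diagonal terms of row
  \<open>i\<close> would total less than 1 by \<open>small\<close>, and neither \<open>z i\<close>
  nor the diagonal term could make up the rest.\<close>

lemma coupled_system_nonneg:
  fixes a z :: "'n::finite \<Rightarrow> real" and w :: "'n \<Rightarrow> 'n \<Rightarrow> real"
  assumes a: "\<And>j. 0 \<le> a j"
    and w: "\<And>i j. 0 \<le> w i j" "\<And>i j. w i j \<le> 1" "\<And>i. w i i = 1"
    and small: "\<And>i. (\<Sum>j\<in>UNIV - {i}. a j / (1 + 2 * a j)) < 1"
    and z: "\<And>i. z i + (\<Sum>j\<in>UNIV. a j * (w i j * (z i + z j))) = 1"
  shows "0 \<le> z k"
proof -
  obtain i where i: "\<And>j. z i \<le> z j"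
    using ex_is_arg_min_if_finite[of "UNIV :: 'n set" z]
    by (auto simp: is_arg_min_linorder)
  have "0 \<le> z i"
  proof (rule ccontr)
    assume neg: "\<not> 0 \<le> z i"
    have bound: "a j * (w i j * (z i + z j)) \<le> a j / (1 + 2 * a j)" for j
    proof (cases "0 \<le> z i + z j")
      case True
      \<comment> \<open>Since \<open>z i\<close> is least, row \<open>j\<close> has only nonnegative
        coupling terms; its diagonal one, of weight 1, already caps \<open>z j\<close>.\<close>
      have pos: "0 \<le> z j + z k" for k
        using True i[of k] by linarith
      have "a j * (w j j * (z j + z j)) \<le> (\<Sum>k\<in>UNIV. a k * (w j k * (z j + z k)))"
        by (rule member_le_sum) (auto intro!: mult_nonneg_nonneg a w pos)
      then have "z j * (1 + 2 * a j) \<le> 1"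
        using z[of j] by (simp add: w algebra_simps)
      then have zj: "z j \<le> 1 / (1 + 2 * a j)"
        using a[of j] by (simp add: field_simps)
      have "w i j * (z i + z j) \<le> 1 * (z i + z j)"
        using True w by (intro mult_right_mono)
      also have "\<dots> \<le> z j"
        using neg by simp
      also note zj
      finally show ?thesis
        using mult_left_mono[OF _ a[of j]] by fastforce
    next
      case False
      then have "a j * (w i j * (z i + z j)) \<le> 0"
        by (intro mult_nonneg_nonpos a w) auto
      also have "0 \<le> a j / (1 + 2 * a j)"
        using a[of j] by simp
      finally show ?thesis .
    qed
    have "(\<Sum>j\<in>UNIV. a j * (w i j * (z i + z j)))
        = a i * (w i i * (z i + z i)) + (\<Sum>j\<in>UNIV - {i}. a j * (w i j * (z i + z j)))"
      by (rule sum.remove) auto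
    also have "\<dots> \<le> 0 + (\<Sum>j\<in>UNIV - {i}. a j / (1 + 2 * a j))"
      using neg a w by (intro add_mono sum_mono bound mult_nonneg_nonpos) auto
    finally show False
      using z[of i] small[of i] neg by linarith
  qed
  with i[of k] show ?thesis by linarith
qed

text \<open>There are \<open>N - 1\<close> summands, each below \<open>1 / (N - 1)\<close>: clearing
  denominators, this is \<open>(N - 3) * a j < 1\<close>.\<close>

lemma sum_others_less_1:
  fixes a :: "'n::finite \<Rightarrow> real"
  assumes N: "2 \<le> CARD('n)" and a: "\<And>j. 0 \<le> a j" "\<And>j. (real CARD('n) - 3) * a j < 1"
  shows "(\<Sum>j\<in>UNIV - {i}. a j / (1 + 2 * a j)) < 1"
proof -
  have N1: "0 < real CARD('n) - 1"
    using N by simp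
  have card: "card (UNIV - {i}) = CARD('n) - 1"
    by (simp add: card_Diff_subset)
  then have ne: "UNIV - {i} \<noteq> {}"
    using N by (metis card.empty diff_is_0_eq not_less_eq_eq numeral_2_eq_2 One_nat_def)
  have "a j / (1 + 2 * a j) < 1 / (real CARD('n) - 1)" for j
    using a(1)[of j] a(2)[of j] N1 by (simp add: field_simps)
  then have "(\<Sum>j\<in>UNIV - {i}. a j / (1 + 2 * a j)) < (\<Sum>j\<in>UNIV - {i}. 1 / (real CARD('n) - 1))"
    by (intro sum_strict_mono ne) auto
  also have "\<dots> = 1"
    using N1 N card by (simp add: of_nat_diff)
  finally show ?thesis .
qed

text \<open>It puts the whole diagonal into the pattern. If \<open>2 * u i \<le> cs i\<close>, the
  diagonal term of row \<open>i\<close> vanishes and the other terms total less than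
  \<open>cs i / 2\<close>, so the row cannot reach \<open>cs i\<close>.\<close>

lemma half_cost_less_dual:
  fixes a cs u :: "'n::finite \<Rightarrow> real" and cp :: "'n \<Rightarrow> 'n \<Rightarrow> real"
  assumes a: "\<And>j. 0 \<le> a j"
    and c: "\<And>i. 0 < cs i" "\<And>i. cp i i = cs i" "\<And>i j. cs i \<le> cp i j" "\<And>i j. cs j \<le> cp i j"
    and small: "\<And>i. (\<Sum>j\<in>UNIV - {i}. a j / (1 + 2 * a j)) < 1"
    and u: "\<And>i. u i + (\<Sum>j\<in>UNIV. a j * max 0 (u i + u j - cp i j)) = cs i"
  shows "cs i < 2 * u i"
proof (rule ccontr)
  assume "\<not> cs i < 2 * u i"
  then have i: "2 * u i \<le> cs i" by simp
  have upper: "u k * (1 + 2 * a k) \<le> cs k * (1 + a k)" for k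
  proof -
    have "a k * (2 * u k - cs k) \<le> a k * max 0 (u k + u k - cp k k)"
      by (intro mult_left_mono a) (simp add: c)
    also have "\<dots> \<le> (\<Sum>j\<in>UNIV. a j * max 0 (u k + u j - cp k j))"
      by (rule member_le_sum) (auto simp: a)
    finally show ?thesis
      using u[of k] by (simp add: algebra_simps)
  qed
  \<comment> \<open>The cap on \<open>u k\<close> has the factor
    \<open>(1 + a k) / (1 + 2 * a k) = 1 - a k / (1 + 2 * a k)\<close>. Enlarging
    \<open>cs k\<close> to \<open>cp i k\<close> lets the cost cancel, and the deficit that remains
    is at least the one with \<open>cs i\<close>.\<close>
  have bound: "a k * max 0 (u i + u k - cp i k) \<le> cs i / 2 * (a k / (1 + 2 * a k))" for k
  proof -
    have "u k \<le> cs k * (1 + a k) / (1 + 2 * a k)"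
      using upper[of k] a[of k] by (simp add: field_simps)
    also have "\<dots> \<le> cp i k * (1 + a k) / (1 + 2 * a k)"
      using a[of k] c(4)[where i=i and j=k] by (intro divide_right_mono mult_right_mono) auto
    also have "\<dots> = cp i k - cp i k * (a k / (1 + 2 * a k))"
      using a[of k] by (simp add: field_simps)
    also have "\<dots> \<le> cp i k - cs i * (a k / (1 + 2 * a k))"
      using a[of k] c(3)[where i=i and j=k] by (intro diff_left_mono mult_right_mono) auto
    finally have "u i + u k - cp i k \<le> cs i / 2 - cs i * (a k / (1 + 2 * a k))"
      using i by linarith
    also have "\<dots> = cs i / 2 * (1 / (1 + 2 * a k))"
      using a[of k] by (simp add: field_simps)
    finally have "max 0 (u i + u k - cp i k) \<le> cs i / 2 * (1 / (1 + 2 * a k))"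
      using a[of k] c(1)[of i] by simp
    from mult_left_mono[OF this a[of k]] show ?thesis
      by (simp add: mult_ac)
  qed
  have "(\<Sum>j\<in>UNIV. a j * max 0 (u i + u j - cp i j))
      = a i * max 0 (u i + u i - cp i i) + (\<Sum>j\<in>UNIV - {i}. a j * max 0 (u i + u j - cp i j))"
    by (rule sum.remove) auto
  also have "\<dots> \<le> 0 + (\<Sum>j\<in>UNIV - {i}. cs i / 2 * (a j / (1 + 2 * a j)))"
    using i by (intro add_mono sum_mono bound) (simp add: c)
  also have "\<dots> = cs i / 2 * (\<Sum>j\<in>UNIV - {i}. a j / (1 + 2 * a j))"
    by (simp add: sum_distrib_left)
  also have "\<dots> < cs i / 2"
    using small[of i] c(1)[of i] by simp
  finally show False
    using u[of i] i by linarith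
qed

section \<open>Lower and upper bounds for the value\<close>

text \<open>Weak duality. For given \<open>u\<close>, the least capacity multiplier satisfying the
  dual constraint of \<open>x $ i $ j\<close> is \<open>max 0 (u i + u j - cp i j) / t\<close>;
  inserting it into the dual constraint of \<open>y $ i\<close> gives the hypothesis on
  \<open>u\<close>.\<close>

lemma dual_le_lp_value:
  fixes cs u :: "'n::finite \<Rightarrow> real"
  assumes t: "0 < t" "\<And>i. \<theta> i = t" and p: "\<And>i. 0 \<le> p $ i"
    and u: "\<And>i. u i + (\<Sum>j\<in>UNIV. p $ j / t * max 0 (u i + u j - cp i j)) \<le> cs i"
  shows "(\<Sum>i\<in>UNIV. p $ i * u i) \<le> lp_value cs cp \<theta> p"
proof -
  obtain x y where z: "(x, y) \<in> lp_feasible \<theta> p"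
    and val: "lp_objective cs cp (x, y) = lp_value cs cp \<theta> p"
    using lp_value_attained[OF p, of \<theta> cs cp] by (metis surj_pair)
  define v where "v i j = max 0 (u i + u j - cp i j)" for i j
  from z have eq: "\<And>i. (\<Sum>j\<in>UNIV. x $ j $ i) + (\<Sum>j\<in>UNIV. x $ i $ j) + y $ i = p $ i"
    and cap: "\<And>i j. t * x $ i $ j \<le> p $ j * y $ i"
    and x: "\<And>i j. 0 \<le> x $ i $ j" and y: "\<And>i. 0 \<le> y $ i"
    by (auto simp: lp_feasible_def t)
  have "(\<Sum>i\<in>UNIV. p $ i * u i)
      = (\<Sum>i\<in>UNIV. \<Sum>j\<in>UNIV. u i * x $ j $ i) + (\<Sum>i\<in>UNIV. \<Sum>j\<in>UNIV. u i * x $ i $ j)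
        + (\<Sum>i\<in>UNIV. u i * y $ i)"
    by (simp add: eq[symmetric] sum.distrib algebra_simps sum_distrib_left)
  also have "(\<Sum>i\<in>UNIV. \<Sum>j\<in>UNIV. u i * x $ j $ i) = (\<Sum>i\<in>UNIV. \<Sum>j\<in>UNIV. u j * x $ i $ j)"
    by (rule sum.swap)
  also have "\<dots> + (\<Sum>i\<in>UNIV. \<Sum>j\<in>UNIV. u i * x $ i $ j) + (\<Sum>i\<in>UNIV. u i * y $ i)
      = (\<Sum>i\<in>UNIV. (\<Sum>j\<in>UNIV. (u i + u j) * x $ i $ j) + u i * y $ i)"
    by (simp add: sum.distrib algebra_simps)
  also have "\<dots> \<le> (\<Sum>i\<in>UNIV. (\<Sum>j\<in>UNIV. cp i j * x $ i $ j) + cs i * y $ i)"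
  proof (rule sum_mono)
    fix i
    have "(u i + u j) * x $ i $ j \<le> cp i j * x $ i $ j + p $ j / t * v i j * y $ i" for j
    proof -
      have "(u i + u j) * x $ i $ j \<le> (cp i j + v i j) * x $ i $ j"
        by (intro mult_right_mono x) (simp add: v_def)
      also have "v i j * x $ i $ j \<le> v i j * (p $ j / t * y $ i)"
        using cap[of i j] t by (intro mult_left_mono) (auto simp: v_def field_simps)
      then have "(cp i j + v i j) * x $ i $ j \<le> cp i j * x $ i $ j + p $ j / t * v i j * y $ i"
        by (simp add: algebra_simps)
      finally show ?thesis .
    qed
    then have "(\<Sum>j\<in>UNIV. (u i + u j) * x $ i $ j) + u i * y $ i
        \<le> (\<Sum>j\<in>UNIV. cp i j * x $ i $ j + p $ j / t * v i j * y $ i) + u i * y $ i"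
      by (intro add_right_mono sum_mono)
    also have "\<dots> = (\<Sum>j\<in>UNIV. cp i j * x $ i $ j)
        + (u i + (\<Sum>j\<in>UNIV. p $ j / t * v i j)) * y $ i"
      by (simp add: sum.distrib sum_distrib_right distrib_right)
    also have "\<dots> \<le> (\<Sum>j\<in>UNIV. cp i j * x $ i $ j) + cs i * y $ i"
      using u[of i] by (intro add_left_mono mult_right_mono y) (simp add: v_def)
    finally show "(\<Sum>j\<in>UNIV. (u i + u j) * x $ i $ j) + u i * y $ i
        \<le> (\<Sum>j\<in>UNIV. cp i j * x $ i $ j) + cs i * y $ i" .
  qed
  also have "\<dots> = lp_objective cs cp (x, y)"
    by (simp add: lp_objective_def sum.distrib)
  finally show ?thesis
    by (simp add: val)
qed

text \<open>Combining the balance equations with arbitrary weights \<open>u\<close> rewrites the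
  cost of the pattern point through row residuals. When \<open>u\<close> is the dual vector of a
  nearby point, these residuals are small.\<close>

lemma lp_value_le_pattern:
  fixes cs u z :: "'n::finite \<Rightarrow> real"
  assumes t: "0 < t" "\<And>i. \<theta> i = t" and l: "\<And>i. 0 \<le> l $ i"
    and w: "\<And>i j. 0 \<le> w i j" "\<And>i j. w i j \<le> 1" "\<And>i j. w i j = w j i"
    and z: "\<And>i. z i + (\<Sum>j\<in>UNIV. l $ j / t * (w i j * (z i + z j))) = 1" "\<And>i. 0 \<le> z i"
  shows "lp_value cs cp \<theta> l \<le> (\<Sum>i\<in>UNIV. l $ i * u i)
    - (\<Sum>i\<in>UNIV. l $ i * z i * (u i + (\<Sum>j\<in>UNIV. l $ j / t * (w i j * (u i + u j - cp i j))) - cs i))"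
proof -
  define y :: "real ^ 'n" where "y = (\<chi> i. l $ i * z i)"
  \<comment> \<open>\<open>w i j\<close> is the fraction used of the capacity
    \<open>l $ j * y $ i / t\<close>. Symmetry of \<open>w\<close> turns the balance at
    \<open>i\<close> into \<open>l $ i\<close> times the equation for \<open>z\<close>.\<close>
  define x :: "real ^ 'n ^ 'n" where "x = (\<chi> i j. w i j * (l $ i * l $ j * z i / t))"
  have eq: "(\<Sum>j\<in>UNIV. x $ j $ i) + (\<Sum>j\<in>UNIV. x $ i $ j) + y $ i = l $ i" for i
  proof -
    have "(\<Sum>j\<in>UNIV. x $ j $ i) + (\<Sum>j\<in>UNIV. x $ i $ j) + y $ i
        = l $ i * (z i + (\<Sum>j\<in>UNIV. l $ j / t * (w i j * (z i + z j))))"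
    proof -
      have "x $ j $ i + x $ i $ j = l $ i * (l $ j / t * (w i j * (z i + z j)))" for j
        using w(3)[of j i] by (simp add: x_def algebra_simps add_divide_distrib)
      then show ?thesis
        unfolding distrib_left sum_distrib_left sum.distrib[symmetric]
        by (simp add: y_def)
    qed
    then show ?thesis
      unfolding z(1) by simp
  qed
  have feas: "(x, y) \<in> lp_feasible \<theta> l"
    unfolding lp_feasible_def
  proof (clarsimp simp: t eq, intro conjI allI)
    fix i j
    have "w i j * (l $ i * l $ j * z i) \<le> 1 * (l $ i * l $ j * z i)"
      by (intro mult_right_mono w mult_nonneg_nonneg l z)
    then show "t * x $ i $ j \<le> l $ j * y $ i"
      using t by (simp add: x_def y_def mult_ac)
    show "0 \<le> x $ i $ j" "0 \<le> y $ i"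
      using t unfolding x_def y_def by (auto intro!: mult_nonneg_nonneg divide_nonneg_nonneg l w z)
  qed
  obtain q where val: "lp_objective cs cp q = lp_value cs cp \<theta> l"
    and q: "\<And>w. w \<in> lp_feasible \<theta> l \<Longrightarrow> lp_objective cs cp q \<le> lp_objective cs cp w"
    by (rule lp_value_attained[OF l, of \<theta> cs cp]) blast
  have "lp_value cs cp \<theta> l \<le> lp_objective cs cp (x, y)"
    using q[OF feas] val by simp
  also have "\<dots> = (\<Sum>i\<in>UNIV. l $ i * u i)
    - (\<Sum>i\<in>UNIV. l $ i * z i * (u i + (\<Sum>j\<in>UNIV. l $ j / t * (w i j * (u i + u j - cp i j))) - cs i))"
  proof -
    have "(\<Sum>i\<in>UNIV. l $ i * u i)
      = (\<Sum>i\<in>UNIV. \<Sum>j\<in>UNIV. u i * x $ j $ i) + (\<Sum>i\<in>UNIV. \<Sum>j\<in>UNIV. u i * x $ i $ j)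
        + (\<Sum>i\<in>UNIV. u i * y $ i)"
      by (simp add: eq[symmetric] sum.distrib algebra_simps sum_distrib_left)
    also have "(\<Sum>i\<in>UNIV. \<Sum>j\<in>UNIV. u i * x $ j $ i) = (\<Sum>i\<in>UNIV. \<Sum>j\<in>UNIV. u j * x $ i $ j)"
      by (rule sum.swap)
    finally have dual: "(\<Sum>i\<in>UNIV. l $ i * u i)
      = (\<Sum>i\<in>UNIV. (\<Sum>j\<in>UNIV. (u i + u j) * x $ i $ j) + u i * y $ i)"
      by (simp add: sum.distrib algebra_simps)
    have row: "l $ i * z i * (u i + (\<Sum>j\<in>UNIV. l $ j / t * (w i j * (u i + u j - cp i j))) - cs i)
      = (\<Sum>j\<in>UNIV. (u i + u j) * x $ i $ j) + u i * y $ i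
        - ((\<Sum>j\<in>UNIV. cp i j * x $ i $ j) + cs i * y $ i)" for i
    proof -
      have "(\<Sum>j\<in>UNIV. (u i + u j) * x $ i $ j) - (\<Sum>j\<in>UNIV. cp i j * x $ i $ j)
        = l $ i * z i * (\<Sum>j\<in>UNIV. l $ j / t * (w i j * (u i + u j - cp i j)))"
        unfolding sum_subtractf[symmetric] sum_distrib_left x_def
        by (intro sum.cong) (simp_all add: algebra_simps add_divide_distrib diff_divide_distrib)
      then show ?thesis
        by (simp add: algebra_simps y_def)
    qed
    show ?thesis
      unfolding dual row by (simp add: lp_objective_def sum_subtractf sum.distrib)
  qed
  finally show ?thesis .
qed

section \<open>A uniform quadratic support at each point of the box\<close>

theorem proposition9:
  fixes cs :: "'n::finite \<Rightarrow> real"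
    and cp :: "'n \<Rightarrow> 'n \<Rightarrow> real"
    and \<theta> :: "'n \<Rightarrow> real"
    and \<theta>\<^sub>0 :: real
    and lo hi :: "real ^ 'n"
  assumes "\<And>i. 0 < cs i"
    and "\<And>i j. 0 < cp i j"
    and "\<And>i. cs i = cp i i"
    and "\<And>i j. cs i \<le> cp i j"
    and "\<And>i j. cp i j = cp j i"
    and "\<And>i. 0 < \<theta> i"
    and "\<And>i. 0 < lo $ i"
    and "4 \<le> CARD('n)"
    and "\<And>i. \<theta> i = \<theta>\<^sub>0"
    and "\<And>i. hi $ i < \<theta>\<^sub>0 / (real CARD('n) - 3)"
  shows "weakly_concave_on (cbox lo hi) (lp_value cs cp \<theta>)"
proof -
  define t where "t = \<theta>\<^sub>0"
  have t: "0 < t" "\<And>i. \<theta> i = t"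
    using assms(6,9) by (auto simp: t_def dest: spec)
  have N3: "1 \<le> real CARD('n) - 3"
    using assms(8) by linarith
  have pos: "0 \<le> l $ i" and less: "(real CARD('n) - 3) * (l $ i / t) < 1" and le: "l $ i \<le> t"
    if "l \<in> cbox lo hi" for l i
  proof -
    have l: "lo $ i \<le> l $ i" "l $ i \<le> hi $ i"
      using that by (auto simp: mem_box_cart)
    show "0 \<le> l $ i"
      using l assms(7)[of i] by linarith
    have lt: "l $ i < t / (real CARD('n) - 3)"
      using l assms(10)[of i] by (simp add: t_def)
    then show "(real CARD('n) - 3) * (l $ i / t) < 1"
      using N3 t by (simp add: field_simps)
    have "t / (real CARD('n) - 3) \<le> t / 1"
      using N3 t(1) by (intro divide_left_mono) auto
    then show "l $ i \<le> t"
      using lt by simp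
  qed
  have small: "(\<Sum>j\<in>UNIV - {i}. (l $ j / t) / (1 + 2 * (l $ j / t))) < 1" if "l \<in> cbox lo hi" for l i
    by (rule sum_others_less_1[of "\<lambda>j. l $ j / t"])
      (use assms(8) t pos[OF that] less[OF that] in auto)
  define B where "B = sum cs UNIV"
  have cs_le: "cs i \<le> B" for i
    unfolding B_def using assms(1) by (intro member_le_sum) (auto intro: less_imp_le)
  then have B: "0 \<le> B"
    using assms(1) by (meson less_imp_le order_trans)
  \<comment> \<open>The factor \<open>3 * D l\<close> bounds the change of \<open>y\<close>, and
    \<open>2 * B / t * D l\<close> bounds a row residual. Summing gives one factor \<open>N\<close>,
    and \<open>D l \<le> N * norm (l - p)\<close> gives two more.\<close>
  define C where "C = 6 * B / t * real CARD('n) ^ 3"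
  show ?thesis
  proof (rule weakly_concave_onI_quadratic_support)
    show "convex (cbox lo hi)" by (rule convex_box)
    show "0 \<le> C" using B t by (simp add: C_def)
    fix p assume p: "p \<in> cbox lo hi"
    obtain u where u: "\<And>i. u i + (\<Sum>j\<in>UNIV. p $ j / t * max 0 (u i + u j - cp i j)) = cs i"
      and uB: "\<And>i. \<bar>u i\<bar> \<le> B"
    proof (rule coupled_system_solvable[of "\<lambda>j. p $ j / t" cs B "\<lambda>i j s. max 0 (s - cp i j)"])
      show "continuous_on UNIV (\<lambda>s. max 0 (s - cp i j))" for i j
        by (intro continuous_intros)
      show "max 0 (s - cp i j) \<le> max 0 s" for i j s
        using assms(2)[of i j] by auto
    qed (use t pos[OF p] cs_le assms(1) in \<open>auto simp: abs_of_pos\<close>)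
    \<comment> \<open>Complementary slackness at \<open>p\<close>: capacity is exhausted exactly
      where its multiplier is positive. The pattern is frozen here and reused at every
      \<open>l\<close>.\<close>
    define w :: "'n \<Rightarrow> 'n \<Rightarrow> real" where "w i j = (if cp i j < u i + u j then 1 else 0)" for i j
    have wmax: "w i j * (u i + u j - cp i j) = max 0 (u i + u j - cp i j)" for i j
      by (simp add: w_def)
    have w: "0 \<le> w i j" "w i j \<le> 1" "w i j = w j i" for i j
      by (auto simp: w_def assms(5)[of j i] add.commute)
    have half: "cs i < 2 * u i" for i
    proof (rule half_cost_less_dual[of "\<lambda>j. p $ j / t" cs cp u])
      show "cs j \<le> cp i j" for i j
        using assms(4)[of j i] assms(5)[of i j] by simp
    qed (use assms(1,3,4) t pos[OF p] small[OF p] u in auto)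
    have loop: "w i i = 1" for i
      using half[of i] by (simp add: w_def assms(3))
    have "\<exists>z. (\<forall>i. z i + (\<Sum>j\<in>UNIV. l $ j / t * (w i j * (z i + z j))) = 1) \<and> (\<forall>i. \<bar>z i\<bar> \<le> 1)"
      if l: "l \<in> cbox lo hi" for l
    proof (rule coupled_system_solvable[of "\<lambda>j. l $ j / t" "\<lambda>i. 1" 1 "\<lambda>i j s. w i j * s"])
      show "continuous_on UNIV (\<lambda>s. w i j * s)" for i j
        by (intro continuous_intros)
    qed (use t pos[OF l] in \<open>auto simp: w_def\<close>)
    then obtain Z where Z:
      "\<And>l i. l \<in> cbox lo hi \<Longrightarrow> Z l i + (\<Sum>j\<in>UNIV. l $ j / t * (w i j * (Z l i + Z l j))) = 1"
      and Z1: "\<And>l i. l \<in> cbox lo hi \<Longrightarrow> \<bar>Z l i\<bar> \<le> 1"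
      by metis
    have Z0: "0 \<le> Z l i" if l: "l \<in> cbox lo hi" for l i
      by (rule coupled_system_nonneg[of "\<lambda>j. l $ j / t" w "Z l"])
        (use t pos[OF l] w(1,2) loop small[OF l] Z[OF l] in auto)
    define D where "D l = (\<Sum>j\<in>UNIV. \<bar>l $ j - p $ j\<bar>)" for l :: "real ^ 'n"
    have D: "\<bar>l $ j - p $ j\<bar> \<le> D l" for l j
      unfolding D_def by (rule member_le_sum) auto
    have Dn: "D l \<le> real CARD('n) * norm (l - p)" for l
      unfolding D_def using sum_bounded_above[of UNIV "\<lambda>j. \<bar>l $ j - p $ j\<bar>" "norm (l - p)"]
        component_le_norm_cart[of "l - p"] by simp
    have D0: "0 \<le> D l" for l
      unfolding D_def by (simp add: sum_nonneg)
    \<comment> \<open>The difference solves the system at \<open>l\<close> with a right-hand side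
      linear in \<open>p - l\<close>, so the maximum principle applies.\<close>
    have Zlip: "\<bar>Z l i - Z p i\<bar> \<le> 2 * D l / t" if l: "l \<in> cbox lo hi" for l i
    proof (rule coupled_system_abs_le[of "\<lambda>j. l $ j / t" w])
      fix i
      let ?d = "\<lambda>j. Z l j - Z p j"
      have "?d i + (\<Sum>j\<in>UNIV. l $ j / t * (w i j * (?d i + ?d j)))
        = (\<Sum>j\<in>UNIV. (p $ j - l $ j) / t * (w i j * (Z p i + Z p j)))
          + (Z l i + (\<Sum>j\<in>UNIV. l $ j / t * (w i j * (Z l i + Z l j))))
          - (Z p i + (\<Sum>j\<in>UNIV. p $ j / t * (w i j * (Z p i + Z p j))))"
      proof -
        have "l $ j / t * (w i j * (?d i + ?d j))
          = (p $ j - l $ j) / t * (w i j * (Z p i + Z p j))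
            + l $ j / t * (w i j * (Z l i + Z l j)) - p $ j / t * (w i j * (Z p i + Z p j))" for j
          by (simp add: diff_divide_distrib algebra_simps)
        then show ?thesis
          by (simp add: sum.distrib sum_subtractf)
      qed
      also have "\<dots> = (\<Sum>j\<in>UNIV. (p $ j - l $ j) / t * (w i j * (Z p i + Z p j)))"
        unfolding Z[OF l] Z[OF p] by simp
      also have "\<bar>\<dots>\<bar> \<le> (\<Sum>j\<in>UNIV. \<bar>l $ j - p $ j\<bar> / t * 2)"
      proof (rule order_trans[OF sum_abs sum_mono])
        fix j
        have "\<bar>w i j * (Z p i + Z p j)\<bar> \<le> 2"
          using Z1[OF p, of i] Z1[OF p, of j] by (auto simp: w_def)
        then have "\<bar>l $ j - p $ j\<bar> / t * \<bar>w i j * (Z p i + Z p j)\<bar> \<le> \<bar>l $ j - p $ j\<bar> / t * 2"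
          using t by (intro mult_left_mono) auto
        then show "\<bar>(p $ j - l $ j) / t * (w i j * (Z p i + Z p j))\<bar> \<le> \<bar>l $ j - p $ j\<bar> / t * 2"
          using t by (simp add: abs_mult abs_divide abs_minus_commute)
      qed
      also have "\<dots> = 2 * D l / t"
        by (simp add: D_def sum_distrib_left sum_divide_distrib mult.commute)
      finally show "\<bar>?d i + (\<Sum>j\<in>UNIV. l $ j / t * (w i j * (?d i + ?d j)))\<bar> \<le> 2 * D l / t" .
    qed (use t pos[OF l] w in auto)
    have Ylip: "\<bar>l $ i * Z l i - p $ i * Z p i\<bar> \<le> 3 * D l" if l: "l \<in> cbox lo hi" for l i
    proof -
      have "l $ i * Z l i - p $ i * Z p i = (l $ i - p $ i) * Z l i + p $ i * (Z l i - Z p i)"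
        by (simp add: algebra_simps)
      also have "\<bar>\<dots>\<bar> \<le> \<bar>l $ i - p $ i\<bar> * \<bar>Z l i\<bar> + p $ i * \<bar>Z l i - Z p i\<bar>"
        using pos[OF p, of i] by (metis abs_mult abs_of_nonneg abs_triangle_ineq)
      also have "\<dots> \<le> D l * 1 + t * (2 * D l / t)"
        by (intro add_mono mult_mono D Z1 l le p Zlip) (use t D0 in auto)
      finally show ?thesis
        using t by simp
    qed
    define v where "v i j = max 0 (u i + u j - cp i j) / t" for i j
    have v: "\<bar>v i j\<bar> \<le> 2 * B / t" for i j
      using uB[of i] uB[of j] assms(2)[of i j] t
      by (auto simp: v_def abs_divide intro!: divide_right_mono)
    \<comment> \<open>The gradient at \<open>p\<close> of the upper bound. The row residuals
      \<open>E i\<close> introduced below vanish at \<open>p\<close>, so their weights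
      \<open>l $ i * Z l i\<close> may be frozen at \<open>p\<close> to first order.\<close>
    define s :: "real ^ 'n" where "s = (\<chi> j. u j - (\<Sum>i\<in>UNIV. p $ i * Z p i * v i j))"
    show "\<exists>s. \<forall>l\<in>cbox lo hi. lp_value cs cp \<theta> l
      \<le> lp_value cs cp \<theta> p + s \<bullet> (l - p) + C * (norm (l - p))\<^sup>2"
    proof (intro exI[of _ s] ballI)
      fix l assume l: "l \<in> cbox lo hi"
      define E where "E i = (\<Sum>j\<in>UNIV. v i j * (l $ j - p $ j))" for i
      have "\<bar>E i\<bar> \<le> (\<Sum>j\<in>UNIV. 2 * B / t * \<bar>l $ j - p $ j\<bar>)" for i
        unfolding E_def
        by (rule order_trans[OF sum_abs sum_mono]) (simp only: abs_mult mult_right_mono v abs_ge_zero)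
      then have Ebd: "\<bar>E i\<bar> \<le> 2 * B / t * D l" for i
        by (simp add: D_def sum_distrib_left)
      \<comment> \<open>Subtracting the equation that \<open>u\<close> satisfies at \<open>p\<close>
        leaves only the change from \<open>p\<close> to \<open>l\<close>.\<close>
      have row: "u i + (\<Sum>j\<in>UNIV. l $ j / t * (w i j * (u i + u j - cp i j))) - cs i = E i" for i
        unfolding wmax u[of i, symmetric] E_def v_def
        by (simp add: sum_subtractf[symmetric] algebra_simps diff_divide_distrib)
      have "lp_value cs cp \<theta> l \<le> (\<Sum>i\<in>UNIV. l $ i * u i) - (\<Sum>i\<in>UNIV. l $ i * Z l i * E i)"
        using lp_value_le_pattern[where cs = cs and cp = cp and u = u,
            OF t pos[OF l] w Z[OF l] Z0[OF l]]
        by (simp only: row)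
      also have "\<dots> = (\<Sum>i\<in>UNIV. p $ i * u i) + s \<bullet> (l - p)
        - (\<Sum>i\<in>UNIV. (l $ i * Z l i - p $ i * Z p i) * E i)"
      proof -
        have "(\<Sum>j\<in>UNIV. (\<Sum>i\<in>UNIV. p $ i * Z p i * v i j) * (l $ j - p $ j))
          = (\<Sum>i\<in>UNIV. p $ i * Z p i * E i)"
          unfolding E_def sum_distrib_left sum_distrib_right
          by (subst sum.swap) (simp add: mult.assoc)
        then have "s \<bullet> (l - p) = (\<Sum>j\<in>UNIV. u j * (l $ j - p $ j)) - (\<Sum>i\<in>UNIV. p $ i * Z p i * E i)"
          by (simp add: s_def inner_vec_def left_diff_distrib sum_subtractf)
        then show ?thesis
          by (simp add: algebra_simps sum_subtractf)
      qed
      also have "\<dots> \<le> lp_value cs cp \<theta> p + s \<bullet> (l - p) + C * (norm (l - p))\<^sup>2"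
      proof -
        \<comment> \<open>Weak duality makes the support exact at \<open>p\<close>: its constant
          term does not exceed the value there.\<close>
        have "(\<Sum>i\<in>UNIV. p $ i * u i) \<le> lp_value cs cp \<theta> p"
          by (rule dual_le_lp_value[OF t]) (use pos[OF p] u in auto)
        moreover have "- (\<Sum>i\<in>UNIV. (l $ i * Z l i - p $ i * Z p i) * E i) \<le> C * (norm (l - p))\<^sup>2"
        proof -
          have "- (\<Sum>i\<in>UNIV. (l $ i * Z l i - p $ i * Z p i) * E i)
            \<le> (\<Sum>i\<in>UNIV. \<bar>(l $ i * Z l i - p $ i * Z p i) * E i\<bar>)"
            by (rule order_trans[OF abs_ge_minus_self sum_abs])
          also have "\<dots> \<le> (\<Sum>i\<in>(UNIV :: 'n set). 3 * D l * (2 * B / t * D l))"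
            unfolding abs_mult by (intro sum_mono mult_mono Ylip l Ebd) (use D0 in auto)
          also have "\<dots> = 6 * B / t * real CARD('n) * (D l)\<^sup>2"
            by (simp add: power2_eq_square)
          also have "\<dots> \<le> 6 * B / t * real CARD('n) * (real CARD('n) * norm (l - p))\<^sup>2"
            using B t by (intro mult_left_mono power_mono Dn D0) auto
          also have "\<dots> = C * (norm (l - p))\<^sup>2"
            by (simp add: C_def power2_eq_square power3_eq_cube)
          finally show ?thesis .
        qed
        ultimately show ?thesis by linarith
      qed
      finally show "lp_value cs cp \<theta> l \<le> lp_value cs cp \<theta> p + s \<bullet> (l - p) + C * (norm (l - p))\<^sup>2" .
    qed
  qed
qed

end
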